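(* Let $(X,\mu)$ be a probability space, let $T:X\to X$ be a $\mu$-preserving, $\mu$-ergodic transformation, and let $f:X\to\mathbb{D}$ be a measurable function with $\int_X\ln(1-|f|)\,d\mu>-\infty$, where $\mathbb{D}$ is the open unit disk in $\mathbb{C}$. For $E\in\partial\mathbb{D}$ let $$A^{(E,f)}(x)=(1-|f(x)|^2)^{-1/2}\begin{pmatrix}\sqrt E& \frac{-\overline{f(x)}}{\sqrt E}\\ -f(x)\sqrt E&\frac{1}{\sqrt E}\end{pmatrix}.$$ Then, with $E=e^{2\pi i\theta}$, $\theta\in\mathbb{R}/\mathbb{Z}$, $$\int_{\mathbb{R}/\mathbb{Z}}L(T,A^{(E,f)})\,d\theta=-\frac12\int_X\ln(1-|f(x)|^2)\,d\mu .$$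
   Context: For a measurable $A:X\to SL(2,\mathbb{C})$ with $\int_X\ln\|A(x)\|\,d\mu<\infty$, put $A_n(x)=A(T^{n-1}(x))\cdots A(x)$ for $n\ge1$. The Lyapunov exponent of the cocycle $(T,A)$ is $$L(T,A)=\lim_{n\to\infty}\frac1n\int_X\ln\|A_n(x)\|\,d\mu=\inf_{n\ge 1}\frac1n\int_X\ln\|A_n(x)\|\,d\mu\ \ge 0.$$ Here $\|\cdot\|$ is the operator norm. The choice of the square root $\sqrt E$ only changes the cocycle map by a sign and does not affect $L$. *)

theory Defs
  imports "HOL-Probability.Probability"
begin

definition measure_preserving :: "'a measure \<Rightarrow> ('a \<Rightarrow> 'a) \<Rightarrow> bool" where
  "measure_preserving M T \<longleftrightarrow> T \<in> measurable M M \<and>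
     (\<forall>B\<in>sets M. emeasure M (T -` B \<inter> space M) = emeasure M B)"

definition ergodic :: "'a measure \<Rightarrow> ('a \<Rightarrow> 'a) \<Rightarrow> bool" where
  "ergodic M T \<longleftrightarrow>
     (\<forall>B\<in>sets M. T -` B \<inter> space M = B \<longrightarrow> emeasure M B = 0 \<or> emeasure M B = 1)"

primrec cocycle_iter ::
  "('a \<Rightarrow> 'a) \<Rightarrow> ('a \<Rightarrow> complex^2^2) \<Rightarrow> nat \<Rightarrow> 'a \<Rightarrow> complex^2^2" where
  "cocycle_iter T A 0 x = mat 1"
| "cocycle_iter T A (Suc n) x = A ((T ^^ n) x) ** cocycle_iter T A n x"

text \<open>The norm on \<open>complex^2\<close> is the Hermitian one, so \<open>onorm ((*v) B)\<close> is the usual operator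
  norm of \<open>B\<close>. The term for \<open>n = 0\<close> is \<open>0\<close> and does not affect the limit.\<close>

definition lyapunov_exponent ::
  "'a measure \<Rightarrow> ('a \<Rightarrow> 'a) \<Rightarrow> ('a \<Rightarrow> complex^2^2) \<Rightarrow> real" where
  "lyapunov_exponent M T A =
     lim (\<lambda>n. 1 / real n * (\<integral>x. ln (onorm ((*v) (cocycle_iter T A n x))) \<partial>M))"

text \<open>The matrix depends on the spectral parameter \<open>E\<close> only through a square root \<open>s\<close> of \<open>E\<close>;
  \<open>z\<close> stands for the value \<open>f x\<close>.\<close>

definition szego_matrix :: "complex \<Rightarrow> complex \<Rightarrow> complex^2^2" where
  "szego_matrix s z = (1 - (cmod z)\<^sup>2) powr (- 1 / 2) *\<^sub>R
     vector [vector [s,       - cnj z / s],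
             vector [- z * s, 1 / s      ]]"

lemma det_szego_matrix:
  assumes "cmod z < 1" "s \<noteq> 0"
  shows "det (szego_matrix s z) = 1"
proof -
  define c where "c = (1 - (cmod z)\<^sup>2) powr (- 1 / 2)"
  have pos: "1 - (cmod z)\<^sup>2 > 0"
    using assms(1) by (simp add: abs_square_less_1)
  have "c * c = 1 / (1 - (cmod z)\<^sup>2)"
    using pos by (simp add: c_def powr_add [symmetric] powr_minus_divide)
  then have "c * c * (1 - (cmod z)\<^sup>2) = 1"
    using pos by simp
  then have "complex_of_real (c * c * (1 - (cmod z)\<^sup>2)) = 1"
    by simp
  then have *: "complex_of_real c * complex_of_real c * (1 - z * cnj z) = 1"
    by (simp only: of_real_mult of_real_diff of_real_1 complex_norm_square)
  have "det (szego_matrix s z) = complex_of_real c * complex_of_real c * (1 - z * cnj z)"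
    unfolding szego_matrix_def c_def [symmetric] det_2 vector_scaleR_component vector_2
    using assms(2) by (simp add: scaleR_conv_of_real field_simps)
  with * show ?thesis by simp
qed

end

theory Submission
  imports Defs "HOL-Complex_Analysis.Cauchy_Integral_Formula"
begin

text \<open>For \<open>\<bar>E\<bar> = 1\<close> the matrices \<open>A(x)\<close> lie in \<open>SU(1,1)\<close>, so \<open>A\<^sub>n(x)\<close> has the rows
  \<open>(cnj a, cnj b)\<close> and \<open>(b, a)\<close> with \<open>\<bar>a\<bar>\<^sup>2 - \<bar>b\<bar>\<^sup>2 = 1\<close>. Its operator norm is
  \<open>\<bar>a\<bar> + \<bar>b\<bar>\<close> (\<open>onorm_su11_matrix\<close>), hence lies between \<open>\<bar>a\<bar>\<close> and \<open>2\<bar>a\<bar>\<close>. After division by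
  \<open>n\<close> the factor \<open>2\<close> is invisible, and the Lyapunov exponent is the growth rate of the mean of the
  single number \<open>ln \<bar>a\<bar>\<close>.

  This number is harmonic in disguise. Pulling \<open>(1 - \<bar>f\<bar>\<^sup>2)\<^bsup>-1/2\<^esup> / \<surd>E\<close> out of each factor leaves
  \<open>\<bar>a\<bar> = W\<^sub>n(x) \<bar>v\<^sub>n(x, E)\<bar>\<close>, where \<open>W\<^sub>n\<close> is the product of the factors
  \<open>(1 - \<bar>f\<bar>\<^sup>2)\<^bsup>-1/2\<^esup>\<close> along the orbit and \<open>v\<^sub>n(x, z)\<close> is a polynomial in \<open>z\<close>
  (\<open>cocycle_iter_szego\<close>). It satisfies \<open>v\<^sub>n(x, 0) = 1\<close>, and it has no zero in the closed unit disk,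
  because the recursion that produces it preserves the cone \<open>\<bar>u\<bar> < \<bar>v\<bar>\<close> whenever \<open>\<bar>z\<bar> \<le> 1\<close>
  (\<open>szego_column_norm_less\<close>). So \<open>ln \<bar>v\<^sub>n(x, z)\<bar>\<close> is harmonic near the disk, and its mean over the
  circle is its value \<open>0\<close> at the centre. Therefore the mean of \<open>ln \<bar>a\<bar>\<close> over the circle is
  \<open>ln (W\<^sub>n(x))\<close> for every \<open>x\<close> and \<open>n\<close>, and since \<open>T\<close> preserves \<open>\<mu>\<close> the mean over \<open>x\<close> of that is
  \<open>n\<close> times the claimed value (\<open>integral_mean_log_entry\<close>): the formula already holds exactly before
  passing to the limit.

  What remains is to exchange the limit in \<open>n\<close> with the integral over \<open>\<theta>\<close>. The limit exists by
  subadditivity (\<open>subadditive_convergent\<close>), and the averages are bounded uniformly in \<open>n\<close> and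
  \<open>\<theta>\<close> because the norm of \<open>A(x)\<close> is at most \<open>2 (1 - \<bar>f(x)\<bar>\<^sup>2)\<^bsup>-1/2\<^esup>\<close>, so dominated
  convergence applies.\<close>

section \<open>Matrices of SU(1,1) type and their norm\<close>

definition su11_matrix :: "complex \<Rightarrow> complex \<Rightarrow> complex^2^2" where
  "su11_matrix a b = vector [vector [cnj a, cnj b], vector [b, a]]"

lemma su11_matrix_mult:
  "su11_matrix a b ** su11_matrix c d = su11_matrix (a * c + b * cnj d) (a * d + b * cnj c)"
  by (simp add: vec_eq_iff forall_2 matrix_matrix_mult_def sum_2 su11_matrix_def algebra_simps)

lemma norm_vec2: "norm (v :: complex^2) = sqrt ((cmod (v$1))\<^sup>2 + (cmod (v$2))\<^sup>2)"
  by (simp add: norm_vec_def L2_set_def sum_2)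

text \<open>The upper bound splits the matrix into its diagonal and its antidiagonal part, which are multiples
  of isometries. It is attained at the vector of the phases of \<open>a\<close> and \<open>b\<close>, where the two summands
  of each component are aligned.\<close>

lemma onorm_su11_matrix: "onorm ((*v) (su11_matrix a b)) = cmod a + cmod b"
proof (rule antisym)
  show "onorm ((*v) (su11_matrix a b)) \<le> cmod a + cmod b"
  proof (rule onorm_bound)
    fix x :: "complex^2"
    define p q :: "complex^2" where
      "p = vector [cnj a * x$1, a * x$2]" and "q = vector [cnj b * x$2, b * x$1]"
    have "su11_matrix a b *v x = p + q"
      by (simp add: vec_eq_iff forall_2 matrix_vector_mult_def sum_2 su11_matrix_def p_def q_def)
    moreover have "norm p = cmod a * norm x"
      by (simp add: norm_vec2 p_def norm_mult power_mult_distrib real_sqrt_mult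
            flip: distrib_left)
    moreover have "norm q = cmod b * norm x"
      by (simp add: norm_vec2 q_def norm_mult power_mult_distrib real_sqrt_mult add.commute
            flip: distrib_left)
    ultimately show "norm (su11_matrix a b *v x) \<le> (cmod a + cmod b) * norm x"
      using norm_triangle_ineq[of p q] by (simp add: distrib_right)
  qed auto
next
  obtain u where u: "cmod u = 1" "a = of_real (cmod a) * u"
    by (metis rcis_cmod_Arg rcis_def norm_cis)
  obtain v where v: "cmod v = 1" "b = of_real (cmod b) * v"
    by (metis rcis_cmod_Arg rcis_def norm_cis)
  define x :: "complex^2" where "x = vector [u, v]"
  have uv: "cnj u * u = 1" "cnj v * v = 1"
    using u(1) v(1) complex_norm_square[of u] complex_norm_square[of v]
    by (simp_all add: mult.commute)
  have "(su11_matrix a b *v x) $ 1 = cnj a * u + cnj b * v"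
       "(su11_matrix a b *v x) $ 2 = b * u + a * v"
    by (simp_all add: matrix_vector_mult_def sum_2 su11_matrix_def x_def)
  moreover have "cnj a * u + cnj b * v = of_real (cmod a + cmod b)"
  proof -
    have "cnj a * u = of_real (cmod a) * (cnj u * u)"
      by (subst u(2)) (simp add: mult.assoc)
    moreover have "cnj b * v = of_real (cmod b) * (cnj v * v)"
      by (subst v(2)) (simp add: mult.assoc)
    ultimately show ?thesis by (simp add: uv)
  qed
  moreover have "b * u + a * v = of_real (cmod a + cmod b) * (u * v)"
    by (subst u(2), subst v(2)) (simp add: algebra_simps)
  ultimately have "norm (su11_matrix a b *v x) = (cmod a + cmod b) * norm x"
    using u(1) v(1) by (simp add: norm_vec2 x_def norm_mult abs_of_nonneg del: of_real_add)
      (simp add: real_sqrt_mult flip: mult_2_right)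
  moreover have "norm x > 0"
    using u(1) v(1) by (simp add: norm_vec2 x_def)
  moreover have "norm (su11_matrix a b *v x) \<le> onorm ((*v) (su11_matrix a b)) * norm x"
    by (rule onorm) auto
  ultimately show "cmod a + cmod b \<le> onorm ((*v) (su11_matrix a b))"
    by simp
qed

section \<open>Iterates of the Szego cocycle\<close>

definition szego_weight :: "complex \<Rightarrow> real" where
  "szego_weight z = (1 - (cmod z)\<^sup>2) powr (- 1 / 2)"

text \<open>The second column of the product of the matrices with rows \<open>(z, - cnj (c k))\<close> and
  \<open>(- c k * z, 1)\<close> for \<open>k < n\<close>, later factors on the left. These are the Szego matrices with the
  weight and the factor \<open>1 / \<surd>z\<close> removed, so that the entries become polynomials in \<open>z\<close>.\<close>

primrec szego_column :: "(nat \<Rightarrow> complex) \<Rightarrow> nat \<Rightarrow> complex \<Rightarrow> complex \<times> complex" where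
  "szego_column c 0 z = (0, 1)"
| "szego_column c (Suc n) z =
     (z * fst (szego_column c n z) - cnj (c n) * snd (szego_column c n z),
      snd (szego_column c n z) - c n * z * fst (szego_column c n z))"

lemma cnj_eq_inverse_unit: "cmod s = 1 \<Longrightarrow> cnj s = inverse s"
  by (metis complex_norm_square inverse_unique of_real_1 one_power2)

lemma szego_matrix_eq_su11:
  fixes s z :: complex
  assumes "cmod s = 1"
  shows "szego_matrix s z = su11_matrix (szego_weight z / s) (- szego_weight z * z * s)"
  using cnj_eq_inverse_unit[OF assms]
  by (simp add: vec_eq_iff forall_2 szego_matrix_def su11_matrix_def szego_weight_def)
    (simp add: scaleR_conv_of_real field_simps)

text \<open>Both columns of an iterate are determined by the second one, since products of matrices of the form
  \<open>su11_matrix\<close> are of that form again. The moduli of the entries depend on \<open>s\<close> through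
  \<open>s\<^sup>2\<close> only, which is why the choice of the square root does not matter.\<close>

lemma cocycle_iter_szego:
  fixes s :: complex and T :: "'a \<Rightarrow> 'a" and f :: "'a \<Rightarrow> complex"
  assumes s: "cmod s = 1"
  defines "W \<equiv> \<lambda>n x. \<Prod>k<n. szego_weight (f ((T ^^ k) x))"
    and "p \<equiv> \<lambda>n x. szego_column (\<lambda>k. f ((T ^^ k) x)) n (s\<^sup>2)"
  shows "cocycle_iter T (\<lambda>x. szego_matrix s (f x)) n x =
           su11_matrix (W n x * snd (p n x) / s ^ n) (W n x * cnj (fst (p n x) / s ^ n))"
proof (induction n)
  case 0
  show ?case
    by (simp add: vec_eq_iff forall_2 su11_matrix_def W_def p_def mat_def)
next
  case (Suc n)
  have s0: "s \<noteq> 0" using s by auto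
  note cs = cnj_eq_inverse_unit[OF s]
  define z where "z = f ((T ^^ n) x)"
  define w where "w = szego_weight z"
  have W: "W (Suc n) x = W n x * w"
    by (simp add: W_def w_def z_def)
  have p: "p (Suc n) x = (s\<^sup>2 * fst (p n x) - cnj z * snd (p n x), snd (p n x) - z * s\<^sup>2 * fst (p n x))"
    by (simp add: p_def z_def)
  show ?case
    unfolding cocycle_iter.simps Suc
    unfolding szego_matrix_eq_su11[OF s] su11_matrix_mult W p z_def[symmetric] w_def[symmetric]
    using s0 by (intro arg_cong2[where f = su11_matrix])
      (simp_all add: cs field_simps power2_eq_square)
qed

text \<open>The matrix with rows \<open>(1, - cnj a)\<close> and \<open>(- a, 1)\<close> multiplies the Hermitian form
  \<open>\<bar>v\<bar>\<^sup>2 - \<bar>w\<bar>\<^sup>2\<close> by its determinant.\<close>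

lemma norm_diff_hyperbolic:
  "(cmod (v - a * w))\<^sup>2 - (cmod (w - cnj a * v))\<^sup>2 = (1 - (cmod a)\<^sup>2) * ((cmod v)\<^sup>2 - (cmod w)\<^sup>2)"
  unfolding cmod_power2 by (simp add: power2_eq_square algebra_simps)

lemma szego_column_norm_diff:
  assumes "cmod z = 1"
  shows "(cmod (snd (szego_column c n z)))\<^sup>2 - (cmod (fst (szego_column c n z)))\<^sup>2
           = (\<Prod>k<n. 1 - (cmod (c k))\<^sup>2)"
proof (induction n)
  case (Suc n)
  show ?case
    using norm_diff_hyperbolic[of "snd (szego_column c n z)" "c n" "z * fst (szego_column c n z)"]
      Suc assms by (simp add: norm_mult mult.assoc)
qed simp

text \<open>Multiplication of the first component by \<open>z\<close> with \<open>\<bar>z\<bar> \<le> 1\<close> keeps the form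
  \<open>\<bar>v\<bar>\<^sup>2 - \<bar>u\<bar>\<^sup>2\<close> positive, and so does the hyperbolic step. In particular the second
  component has no zero in the closed unit disk.\<close>

lemma szego_column_norm_less:
  assumes "cmod z \<le> 1" "\<And>k. cmod (c k) < 1"
  shows "cmod (fst (szego_column c n z)) < cmod (snd (szego_column c n z))"
proof (induction n)
  case (Suc n)
  define u v where "u = fst (szego_column c n z)" and "v = snd (szego_column c n z)"
  have "cmod (z * u) < cmod v"
    using Suc assms(1) mult_right_mono[of "cmod z" 1 "cmod u"] by (simp add: u_def v_def norm_mult)
  then have "(1 - (cmod (c n))\<^sup>2) * ((cmod v)\<^sup>2 - (cmod (z * u))\<^sup>2) > 0"
    using assms(2)[of n] by (intro mult_pos_pos) (auto simp: abs_square_less_1 intro: power_strict_mono)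
  then have "(cmod (z * u - cnj (c n) * v))\<^sup>2 < (cmod (v - c n * (z * u)))\<^sup>2"
    unfolding norm_diff_hyperbolic[symmetric] by simp
  then show ?case
    by (simp add: u_def v_def mult.assoc power_less_imp_less_base)
qed simp

lemma szego_column_0: "snd (szego_column c n 0) = 1"
  by (induction n) auto

lemma szego_column_holomorphic:
  "(\<lambda>z. fst (szego_column c n z)) holomorphic_on S \<and> (\<lambda>z. snd (szego_column c n z)) holomorphic_on S"
  by (induction n) (auto intro!: holomorphic_intros)

section \<open>The logarithmic mean of a zero-free function\<close>

text \<open>Jensen's formula in the absence of zeros. By compactness \<open>p\<close> is zero-free on a slightly larger
  disk, where it has a holomorphic logarithm \<open>g\<close>. Then \<open>ln \<bar>p\<bar> = Re g\<close>, and Cauchy's formula at the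
  centre of the unit circle is the mean value property of \<open>g\<close>.\<close>

lemma has_integral_ln_norm_circle:
  assumes holo: "p holomorphic_on UNIV" and nz: "\<And>z. cmod z \<le> 1 \<Longrightarrow> p z \<noteq> 0"
  shows "((\<lambda>t. ln (cmod (p (exp (2 * of_real pi * \<i> * of_real t))))) has_integral ln (cmod (p 0))) {0..1}"
proof -
  have cont: "continuous_on UNIV p"
    using holo by (rule holomorphic_on_imp_continuous_on)
  have "open (p -` (- {0}))"
    using cont by (intro open_vimage) auto
  moreover have "cball 0 1 \<subseteq> p -` (- {0})"
    using nz by auto
  ultimately obtain e where e: "e > 0" "(\<Union>x\<in>cball 0 1. ball x e) \<subseteq> p -` (- {0})"
    using compact_subset_open_imp_ball_epsilon_subset[of "cball 0 (1::real) :: complex set"] compact_cball by metis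
  \<comment> \<open>A point of the larger disk outside the closed unit disk is within \<open>e\<close> of its radial projection.\<close>
  have nz': "p z \<noteq> 0" if z: "z \<in> ball 0 (1 + e)" for z
  proof (cases "cmod z \<le> 1")
    case False
    have "sgn z \<in> cball 0 1" using norm_sgn[of z] by auto
    moreover have "dist (sgn z) z = cmod z - 1"
    proof -
      have "sgn z - z = (1 - cmod z) *\<^sub>R sgn z"
        by (cases "z = 0") (auto simp: sgn_div_norm algebra_simps)
      then show ?thesis using False by (auto simp: dist_norm norm_sgn)
    qed
    ultimately have "z \<in> (\<Union>x\<in>cball 0 1. ball x e)"
      using z by (intro UN_I[of "sgn z"]) auto
    then have "z \<in> p -` (- {0})"
      using e(2) by (rule rev_subsetD)
    then show ?thesis by simp
  qed (use nz in auto)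
  obtain g where g: "g holomorphic_on ball 0 (1 + e)" "\<And>z. z \<in> ball 0 (1 + e) \<Longrightarrow> p z = exp (g z)"
    using contractible_imp_holomorphic_log[of p "ball 0 (1 + e)"] nz' holo holomorphic_on_subset
      convex_imp_contractible convex_ball by (metis subset_UNIV)
  have sub: "cball (0::complex) 1 \<subseteq> ball 0 (1 + e)"
    using e(1) by auto
  have "((\<lambda>u. g u / (u - 0)) has_contour_integral 2 * of_real pi * \<i> * g 0) (circlepath 0 1)"
    using holomorphic_on_subset[OF g(1) sub]
    by (intro Cauchy_integral_circlepath)
      (auto intro: holomorphic_on_imp_continuous_on holomorphic_on_subset)
  then have "((\<lambda>t. g (circlepath 0 1 t) / circlepath 0 1 t * (2 * pi * \<i> * exp (2 * of_real pi * \<i> * t)))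
      has_integral 2 * of_real pi * \<i> * g 0) {0..1}"
    unfolding has_contour_integral_def
    by (rule has_integral_eq[rotated]) (simp add: vector_derivative_circlepath01)
  then have "((\<lambda>t. 2 * pi * \<i> * g (exp (2 * of_real pi * \<i> * of_real t))) has_integral 2 * of_real pi * \<i> * g 0) {0..1}"
    by (rule has_integral_eq[rotated]) (simp add: circlepath_def part_circlepath_def linepath_def algebra_simps)
  from has_integral_mult_right[OF this, of "1 / (2 * pi * \<i>)"]
  have "((\<lambda>t. g (exp (2 * of_real pi * \<i> * of_real t))) has_integral g 0) {0..1}"
    by simp
  from has_integral_Re[OF this] 
  have "((\<lambda>t. Re (g (exp (2 * of_real pi * \<i> * of_real t)))) has_integral Re (g 0)) {0..1}" .
  moreover have "ln (cmod (p z)) = Re (g z)" if "cmod z \<le> 1" for z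
    using g(2)[of z] that e(1) by simp
  ultimately show ?thesis
    by (simp add: norm_exp_i_times)
qed

section \<open>Subadditive sequences and iterates of measure-preserving maps\<close>

text \<open>Fekete's lemma: the limit is the infimum of the quotients. If \<open>m\<close> nearly attains it, write
  \<open>n = q m + r\<close> with \<open>r < m\<close>; then \<open>a n\<close> is at most \<open>q * a m\<close> up to a constant that depends on
  \<open>m\<close> only.\<close>

lemma subadditive_convergent:
  fixes a :: "nat \<Rightarrow> real"
  assumes sub: "\<And>m n. a (m + n) \<le> a m + a n" and nonneg: "\<And>n. 0 \<le> a n"
  shows "convergent (\<lambda>n. a n / real n)"
proof -
  define l where "l = (INF n\<in>{1..}. a n / real n)"
  have bdd: "bdd_below ((\<lambda>n. a n / real n) ` {1..})"
    by (rule bdd_belowI2[of _ 0]) (simp add: nonneg)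
  have lower: "l \<le> a n / real n" if "n \<ge> 1" for n
    unfolding l_def using that by (intro cINF_lower bdd) auto
  have mult: "a (q * m) \<le> a 0 + q * a m" for q m
  proof (induction q)
    case (Suc q)
    then show ?case using sub[of m "q * m"] by (simp add: algebra_simps)
  qed simp
  have "(\<lambda>n. a n / real n) \<longlonglongrightarrow> l"
  proof (rule LIMSEQ_I)
    fix e :: real assume e: "e > 0"
    have "\<exists>m\<in>{1..}. a m / real m < l + e / 2"
      using e bdd unfolding l_def by (subst cINF_less_iff[symmetric]) auto
    then obtain m where m: "m \<ge> 1" "a m / real m < l + e / 2" by auto
    define C where "C = a 0 + (a 0 + m * a 1)"
    have C: "C \<ge> 0" by (simp add: C_def nonneg)
    have ub: "a n \<le> n * (a m / m) + C" for n
    proof -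
      have "a n \<le> a ((n div m) * m) + a (n mod m)"
        using sub[of "(n div m) * m" "n mod m"] by simp
      moreover have "a (n mod m) \<le> a 0 + m * a 1"
        using mult[of "n mod m" 1] m(1) nonneg[of 1]
          mult_right_mono[of "real (n mod m)" "real m" "a 1"] by fastforce
      moreover have "real (n div m) * a m \<le> n * (a m / m)"
      proof -
        have "real (n div m) * real m \<le> real n"
          by (metis of_nat_mult of_nat_le_iff div_times_less_eq_dividend)
        then have "real (n div m) \<le> real n / real m"
          using m(1) by (simp add: field_simps)
        from mult_right_mono[OF this nonneg[of m]] show ?thesis by simp
      qed
      ultimately show ?thesis using mult[of "n div m" m] by (simp add: C_def)
    qed
    obtain N where N: "2 * C / e < real N" using reals_Archimedean2 by blast
    show "\<exists>N. \<forall>n\<ge>N. norm (a n / real n - l) < e"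
    proof (intro exI[of _ "Suc N"] allI impI)
      fix n assume n: "n \<ge> Suc N"
      have "a n / n \<le> a m / m + C / n"
        using ub[of n] n by (simp add: field_simps)
      moreover have "C / n < e / 2"
      proof -
        have "2 * C / e < n" using N n by linarith
        then show ?thesis using e n by (simp add: field_simps)
      qed
      ultimately show "norm (a n / real n - l) < e"
        using lower[of n] m(2) n unfolding real_norm_def by linarith
    qed
  qed
  then show ?thesis by (auto simp: convergent_def)
qed

lemma measure_preserving_funpow:
  assumes "measure_preserving M T"
  shows "T ^^ n \<in> measurable M M" "distr M M (T ^^ n) = M"
proof -
  have T: "T \<in> measurable M M" using assms by (simp add: measure_preserving_def)
  have d: "distr M M T = M"
    using assms by (intro measure_eqI) (auto simp: emeasure_distr measure_preserving_def)
  show m: "T ^^ n \<in> measurable M M" for n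
    using T by (rule measurable_compose_n)
  show "distr M M (T ^^ n) = M"
  proof (induction n)
    case (Suc n)
    have "distr M M (T ^^ Suc n) = distr (distr M M (T ^^ n)) M T"
      using T m by (simp add: distr_distr)
    then show ?case by (simp only: Suc d)
  qed (simp add: distr_id[unfolded id_def] id_def)
qed

lemma
  fixes g :: "'a \<Rightarrow> real"
  assumes "measure_preserving M T"
  shows measure_preserving_integrable: "integrable M g \<Longrightarrow> integrable M (\<lambda>x. g ((T ^^ n) x))"
    and measure_preserving_integral:
      "integrable M g \<Longrightarrow> (\<integral>x. g ((T ^^ n) x) \<partial>M) = (\<integral>x. g x \<partial>M)"
  using measure_preserving_funpow[OF assms, of n] integrable_distr[of "T ^^ n" M M g]
    integral_distr[of "T ^^ n" M M g] by auto

section \<open>The norm of the cocycle and its diagonal entry\<close>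

lemma szego_weight_pos: "cmod z < 1 \<Longrightarrow> szego_weight z > 0"
  by (simp add: szego_weight_def powr_gt_zero) (metis abs_norm_cancel abs_square_eq_1 less_irrefl)

lemma szego_weight_square:
  assumes "cmod z < 1"
  shows "(szego_weight z)\<^sup>2 * (1 - (cmod z)\<^sup>2) = 1"
proof -
  have pos: "1 - (cmod z)\<^sup>2 > 0"
    using assms by (simp add: abs_square_less_1)
  have "(szego_weight z)\<^sup>2 = 1 / (1 - (cmod z)\<^sup>2)"
    using pos by (simp add: szego_weight_def power2_eq_square powr_add [symmetric] powr_minus_divide)
  then show ?thesis using pos by simp
qed

lemma ln_szego_weight: "cmod z < 1 \<Longrightarrow> ln (szego_weight z) = - 1 / 2 * ln (1 - (cmod z)\<^sup>2)"
  by (simp add: szego_weight_def ln_powr)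

locale szego_cocycle = prob_space M for M :: "'a measure" +
  fixes T :: "'a \<Rightarrow> 'a" and f :: "'a \<Rightarrow> complex"
  assumes preserving: "measure_preserving M T"
    and f_measurable [measurable]: "f \<in> borel_measurable M"
    and f_disc: "\<And>x. x \<in> space M \<Longrightarrow> cmod (f x) < 1"
    and f_integrable: "integrable M (\<lambda>x. ln (1 - cmod (f x)))"
begin

definition log_norm :: "complex \<Rightarrow> nat \<Rightarrow> 'a \<Rightarrow> real" where
  "log_norm s n x = ln (onorm ((*v) (cocycle_iter T (\<lambda>x. szego_matrix s (f x)) n x)))"

definition weight_prod :: "nat \<Rightarrow> 'a \<Rightarrow> real" where
  "weight_prod n x = (\<Prod>k<n. szego_weight (f ((T ^^ k) x)))"

abbreviation column :: "nat \<Rightarrow> 'a \<Rightarrow> complex \<Rightarrow> complex \<times> complex" where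
  "column n x z \<equiv> szego_column (\<lambda>k. f ((T ^^ k) x)) n z"

text \<open>The logarithm of the modulus of the diagonal entry of the iterate, written through the spectral
  parameter \<open>z = s\<^sup>2\<close> rather than \<open>s\<close>: in this form it is measurable jointly in \<open>z\<close> and \<open>x\<close>,
  whereas an arbitrary choice of square roots need not be measurable.\<close>

definition log_entry :: "complex \<Rightarrow> nat \<Rightarrow> 'a \<Rightarrow> real" where
  "log_entry z n x = ln (weight_prod n x * cmod (snd (column n x z)))"

lemma T_funpow_measurable [measurable]: "T ^^ n \<in> measurable M M"
  by (rule measure_preserving_funpow[OF preserving])

lemma T_funpow_space: "x \<in> space M \<Longrightarrow> (T ^^ n) x \<in> space M"
  using T_funpow_measurable by (rule measurable_space)

lemma coeff_disc: "x \<in> space M \<Longrightarrow> cmod (f ((T ^^ n) x)) < 1"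
  by (intro f_disc T_funpow_space)

lemma weight_prod_pos: "x \<in> space M \<Longrightarrow> weight_prod n x > 0"
  unfolding weight_prod_def by (intro prod_pos ballI szego_weight_pos coeff_disc)

lemma onorm_cocycle:
  assumes "cmod s = 1" and x: "x \<in> space M"
  shows "onorm ((*v) (cocycle_iter T (\<lambda>x. szego_matrix s (f x)) n x)) =
           weight_prod n x * (cmod (snd (column n x (s\<^sup>2))) + cmod (fst (column n x (s\<^sup>2))))"
  using weight_prod_pos[OF x, of n]
  unfolding cocycle_iter_szego[OF assms(1)] onorm_su11_matrix weight_prod_def
  by (simp add: norm_mult norm_divide norm_power assms(1) distrib_left del: prod_pos of_real_prod)

text \<open>The iterate has determinant \<open>\<bar>a\<bar>\<^sup>2 - \<bar>b\<bar>\<^sup>2 = 1\<close>, so its diagonal entry \<open>a\<close> has modulus at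
  least \<open>1\<close>.\<close>

lemma weighted_entry_ge_1:
  assumes z: "cmod z = 1" and x: "x \<in> space M"
  shows "1 \<le> weight_prod n x * cmod (snd (column n x z))"
proof -
  have "(weight_prod n x)\<^sup>2 * (\<Prod>k<n. 1 - (cmod (f ((T ^^ k) x)))\<^sup>2) = 1"
    unfolding weight_prod_def prod_power_distrib prod.distrib[symmetric]
    by (intro prod.neutral ballI szego_weight_square coeff_disc x)
  then have "1 = (weight_prod n x)\<^sup>2 * (cmod (snd (column n x z)))\<^sup>2
      - (weight_prod n x)\<^sup>2 * (cmod (fst (column n x z)))\<^sup>2"
    using szego_column_norm_diff[OF z, of "\<lambda>k. f ((T ^^ k) x)" n] by (metis right_diff_distrib)
  then have "1 \<le> (weight_prod n x * cmod (snd (column n x z)))\<^sup>2"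
    by (simp add: power_mult_distrib del: zero_le_power2)
       (smt (verit) zero_le_power2 mult_nonneg_nonneg)
  then show ?thesis
    using weight_prod_pos[OF x, of n] by (intro power2_le_imp_le[of 1]) simp_all
qed

lemma
  assumes s: "cmod s = 1" and x: "x \<in> space M"
  shows log_entry_nonneg: "0 \<le> log_entry (s\<^sup>2) n x"
    and log_entry_le_log_norm: "log_entry (s\<^sup>2) n x \<le> log_norm s n x"
    and log_norm_le_log_entry: "log_norm s n x \<le> log_entry (s\<^sup>2) n x + ln 2"
proof -
  have z: "cmod (s\<^sup>2) = 1" using s by (simp add: norm_power)
  define W u v where "W = weight_prod n x" and "u = cmod (fst (column n x (s\<^sup>2)))"
    and "v = cmod (snd (column n x (s\<^sup>2)))"
  have W: "W > 0" unfolding W_def by (rule weight_prod_pos[OF x])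
  have Wv: "1 \<le> W * v" unfolding W_def v_def by (rule weighted_entry_ge_1[OF z x])
  have uv: "0 \<le> u" "u < v" unfolding u_def v_def
    using szego_column_norm_less[of "s\<^sup>2" "\<lambda>k. f ((T ^^ k) x)" n] z coeff_disc[OF x] by auto
  have e: "log_entry (s\<^sup>2) n x = ln (W * v)" "log_norm s n x = ln (W * (v + u))"
    by (simp_all add: log_entry_def log_norm_def onorm_cocycle[OF s x] W_def u_def v_def)
  show "0 \<le> log_entry (s\<^sup>2) n x"
    using Wv by (simp add: e)
  show "log_entry (s\<^sup>2) n x \<le> log_norm s n x"
    unfolding e using Wv W uv by (intro ln_mono mult_left_mono) auto
  have "ln (W * (v + u)) \<le> ln (W * v * 2)"
    using Wv W uv by (intro ln_mono) auto
  then show "log_norm s n x \<le> log_entry (s\<^sup>2) n x + ln 2"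
    unfolding e using W uv by (simp add: ln_mult)
qed

text \<open>The cocycle identity, which makes \<open>log_norm\<close> subadditive along orbits.\<close>

lemma cocycle_iter_add:
  "cocycle_iter T A (m + n) x = cocycle_iter T A m ((T ^^ n) x) ** cocycle_iter T A n x"
  by (induction m) (simp_all add: matrix_mul_assoc funpow_add)

lemma log_norm_add:
  assumes s: "cmod s = 1" and x: "x \<in> space M"
  shows "log_norm s (m + n) x \<le> log_norm s m ((T ^^ n) x) + log_norm s n x"
proof -
  define A where "A = cocycle_iter T (\<lambda>x. szego_matrix s (f x))"
  have pos: "0 < onorm ((*v) (A k y))" if "y \<in> space M" for k y
  proof -
    have "cmod (s\<^sup>2) = 1" using s by (simp add: norm_power)
    from weighted_entry_ge_1[OF this that, of k] weight_prod_pos[OF that, of k]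
    have "0 < cmod (snd (column k y (s\<^sup>2)))"
      by (metis mult_zero_right norm_le_zero_iff not_le not_one_le_zero norm_zero zero_less_norm_iff)
    then show ?thesis
      unfolding A_def onorm_cocycle[OF s that]
      using weight_prod_pos[OF that, of k] by (intro mult_pos_pos add_pos_nonneg) auto
  qed
  have "(*v) (A (m + n) x) = (*v) (A m ((T ^^ n) x)) \<circ> (*v) (A n x)"
    by (simp add: fun_eq_iff A_def cocycle_iter_add matrix_vector_mul_assoc)
  then have "onorm ((*v) (A (m + n) x)) \<le> onorm ((*v) (A m ((T ^^ n) x))) * onorm ((*v) (A n x))"
    by (simp add: onorm_compose)
  then have "ln (onorm ((*v) (A (m + n) x))) \<le> ln (onorm ((*v) (A m ((T ^^ n) x))) * onorm ((*v) (A n x)))"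
    using pos[OF x] by (intro ln_mono) auto
  also have "\<dots> = ln (onorm ((*v) (A m ((T ^^ n) x)))) + ln (onorm ((*v) (A n x)))"
    by (intro ln_mult_pos pos x T_funpow_space)
  finally show ?thesis
    by (simp add: log_norm_def A_def)
qed

text \<open>A bound that does not depend on \<open>s\<close>. For one step, the diagonal entry is the weight up to a
  unimodular factor, and the norm is at most twice its modulus.\<close>

lemma log_norm_le_sum:
  assumes s: "cmod s = 1" and x: "x \<in> space M"
  shows "log_norm s n x \<le> (\<Sum>k<n. ln (szego_weight (f ((T ^^ k) x))) + ln 2)"
proof (induction n)
  case 0
  show ?case unfolding log_norm_def onorm_cocycle[OF s x] by (simp add: weight_prod_def)
next
  case (Suc n)
  have "log_norm s 1 ((T ^^ n) x) \<le> ln (szego_weight (f ((T ^^ n) x))) + ln 2"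
    using log_norm_le_log_entry[OF s T_funpow_space[OF x], of 1 n]
    by (simp add: log_entry_def weight_prod_def)
  with log_norm_add[OF s x, of 1 n] Suc show ?case by simp
qed

text \<open>Since \<open>1 - r \<le> 1 - r\<^sup>2 \<le> 1\<close> for \<open>0 \<le> r < 1\<close>, the integrability of \<open>ln (1 - \<bar>f\<bar>)\<close> carries
  over to \<open>ln (1 - \<bar>f\<bar>\<^sup>2)\<close>.\<close>

lemma integrable_ln_weight: "integrable M (\<lambda>x. ln (szego_weight (f x)))"
proof (rule Bochner_Integration.integrable_bound[OF f_integrable])
  show "(\<lambda>x. ln (szego_weight (f x))) \<in> borel_measurable M"
    unfolding szego_weight_def by measurable
  have "norm (ln (szego_weight (f x))) \<le> norm (ln (1 - cmod (f x)))" if x: "x \<in> space M" for x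
  proof -
    define r where "r = cmod (f x)"
    have r: "0 \<le> r" "r < 1" using f_disc[OF x] by (auto simp: r_def)
    then have "r\<^sup>2 \<le> r"
      by (simp add: power2_eq_square mult_left_le)
    moreover from this r have "r\<^sup>2 < 1"
      by linarith
    ultimately have "ln (1 - r) \<le> ln (1 - r\<^sup>2)" "ln (1 - r\<^sup>2) \<le> 0"
      using r by (auto intro!: ln_mono)
    then show ?thesis
      by (simp add: ln_szego_weight[OF f_disc[OF x]] flip: r_def)
  qed
  then show "AE x in M. norm (ln (szego_weight (f x))) \<le> norm (ln (1 - cmod (f x)))"
    by simp
qed

lemma borel_measurable_column:
  assumes [measurable]: "\<xi> \<in> measurable N M" "\<zeta> \<in> borel_measurable N"
  shows "(\<lambda>w. fst (column n (\<xi> w) (\<zeta> w))) \<in> borel_measurable N"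
    and "(\<lambda>w. snd (column n (\<xi> w) (\<zeta> w))) \<in> borel_measurable N"
proof (induction n)
  case (Suc n)
  note [measurable] = Suc
  have [measurable]: "cnj \<in> borel_measurable borel"
    by (intro borel_measurable_continuous_onI continuous_intros)
  { case 1 show ?case by simp }
  { case 2 show ?case by simp }
qed auto

lemma borel_measurable_weight_prod [measurable]: "weight_prod n \<in> borel_measurable M"
  unfolding weight_prod_def szego_weight_def by measurable

lemma borel_measurable_log_entry:
  assumes [measurable]: "\<xi> \<in> measurable N M" "\<zeta> \<in> borel_measurable N"
  shows "(\<lambda>w. log_entry (\<zeta> w) n (\<xi> w)) \<in> borel_measurable N"
  using borel_measurable_column(2)[OF assms] unfolding log_entry_def by measurable

lemma borel_measurable_log_norm:
  assumes s: "cmod s = 1"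
  shows "log_norm s n \<in> borel_measurable M"
proof -
  note [measurable] = borel_measurable_column[of "\<lambda>x. x" M "\<lambda>_. s\<^sup>2" n, simplified]
  have "(\<lambda>x. ln (weight_prod n x * (cmod (snd (column n x (s\<^sup>2))) + cmod (fst (column n x (s\<^sup>2))))))
      \<in> borel_measurable M"
    by measurable
  then show ?thesis
    by (rule measurable_cong[THEN iffD1, rotated]) (simp add: log_norm_def onorm_cocycle[OF s])
qed

end

section \<open>Averaging over the circle\<close>

abbreviation circle_point :: "real \<Rightarrow> complex" where
  "circle_point \<theta> \<equiv> exp (2 * of_real pi * \<i> * of_real \<theta>)"

abbreviation unit_interval :: "real measure" where
  "unit_interval \<equiv> restrict_space lborel {0..<1}"

lemma prob_space_unit_interval: "prob_space unit_interval"
  by (rule prob_space_restrict_space) auto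

lemma circle_point_measurable [measurable]: "circle_point \<in> borel_measurable unit_interval"
  by (rule measurable_restrict_space1) (auto intro!: borel_measurable_continuous_onI continuous_intros)

lemma continuous_integral_unit_interval:
  fixes h :: "real \<Rightarrow> real"
  assumes cont: "continuous_on {0..1} h" and I: "(h has_integral I) {0..1}"
  shows "integrable unit_interval h" and "(\<integral>\<theta>. h \<theta> \<partial>unit_interval) = I"
proof -
  have si: "set_integrable lborel {0..<1} h"
    using borel_integrable_atLeastAtMost'[OF cont] by (rule set_integrable_subset) auto
  then show "integrable unit_interval h"
    by (simp add: integrable_restrict_space set_integrable_def)
  have "(h has_integral (LINT x:{0..<1}|lborel. h x)) {0..<1}"
    using set_borel_integral_eq_integral[OF si] by (simp add: has_integral_iff)
  moreover have "(h has_integral I) {0..<1}"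
    using I by (subst has_integral_spike_set_eq[of _ "{0..1}"]) (auto intro: negligible_subset[of "{1}"])
  ultimately have "(LINT x:{0..<1}|lborel. h x) = I"
    by (rule has_integral_unique)
  then show "(\<integral>\<theta>. h \<theta> \<partial>unit_interval) = I"
    by (simp add: integral_restrict_space set_lebesgue_integral_def)
qed

context szego_cocycle
begin

text \<open>The mean value property applied to the polynomial \<open>v\<^sub>n(x, z)\<close>, which equals \<open>1\<close> at \<open>z = 0\<close>.\<close>

lemma
  assumes x: "x \<in> space M"
  shows log_entry_circle_integrable: "integrable unit_interval (\<lambda>\<theta>. log_entry (circle_point \<theta>) n x)"
    and log_entry_circle_integral:
      "(\<integral>\<theta>. log_entry (circle_point \<theta>) n x \<partial>unit_interval) = ln (weight_prod n x)"
proof -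
  define p where "p z = snd (column n x z)" for z
  have nz: "p z \<noteq> 0" if "cmod z \<le> 1" for z
    using szego_column_norm_less[OF that, of "\<lambda>k. f ((T ^^ k) x)" n] coeff_disc[OF x]
    unfolding p_def by auto
  have holo: "p holomorphic_on UNIV"
    unfolding p_def using szego_column_holomorphic by blast
  have "((\<lambda>\<theta>. ln (cmod (p (circle_point \<theta>)))) has_integral ln (cmod (p 0))) {0..1}"
    by (rule has_integral_ln_norm_circle[OF holo nz])
  moreover have "p 0 = 1"
    by (simp add: p_def szego_column_0)
  ultimately have I: "((\<lambda>\<theta>. ln (cmod (p (circle_point \<theta>)))) has_integral 0) {0..1}"
    by simp
  have cont_p: "continuous_on S p" for S
    using holo holomorphic_on_imp_continuous_on continuous_on_subset by blast
  have cont: "continuous_on {0..1} (\<lambda>\<theta>. ln (cmod (p (circle_point \<theta>))))"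
    by (intro continuous_on_ln continuous_on_norm
          continuous_on_compose2[OF cont_p[of UNIV]] continuous_intros) (auto intro!: nz)
  have eq: "log_entry (circle_point \<theta>) n x = ln (weight_prod n x) + ln (cmod (p (circle_point \<theta>)))" for \<theta>
    unfolding log_entry_def p_def[symmetric]
    by (intro ln_mult_pos weight_prod_pos x) (auto intro!: nz)
  have eq': "(\<lambda>\<theta>. log_entry (circle_point \<theta>) n x)
      = (\<lambda>\<theta>. ln (weight_prod n x) + ln (cmod (p (circle_point \<theta>))))"
    by (rule ext) (rule eq)
  interpret N: prob_space unit_interval by (rule prob_space_unit_interval)
  note * = continuous_integral_unit_interval[OF cont I]
  show "integrable unit_interval (\<lambda>\<theta>. log_entry (circle_point \<theta>) n x)"
    unfolding eq' using *(1) by (intro Bochner_Integration.integrable_add) auto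
  show "(\<integral>\<theta>. log_entry (circle_point \<theta>) n x \<partial>unit_interval) = ln (weight_prod n x)"
    unfolding eq' using * N.prob_space
    by (subst Bochner_Integration.integral_add) (auto simp: space_restrict_space)
qed

lemma
  shows integrable_ln_weight_prod: "integrable M (\<lambda>x. ln (weight_prod n x))"
    and integral_ln_weight_prod:
      "(\<integral>x. ln (weight_prod n x) \<partial>M) = n * (\<integral>x. ln (szego_weight (f x)) \<partial>M)"
proof -
  have eq: "ln (weight_prod n x) = (\<Sum>k<n. ln (szego_weight (f ((T ^^ k) x))))" if "x \<in> space M" for x
    unfolding weight_prod_def using szego_weight_pos[OF coeff_disc[OF that]] by (intro ln_prod) (simp, metis less_irrefl)
  note int = measure_preserving_integrable[OF preserving integrable_ln_weight]
  show "integrable M (\<lambda>x. ln (weight_prod n x))"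
    by (subst Bochner_Integration.integrable_cong[OF refl eq]) (auto intro!: int)
  show "(\<integral>x. ln (weight_prod n x) \<partial>M) = n * (\<integral>x. ln (szego_weight (f x)) \<partial>M)"
    by (subst Bochner_Integration.integral_cong[OF refl eq])
      (simp_all add: int measure_preserving_integral[OF preserving integrable_ln_weight])
qed

section \<open>Integration over the phase space\<close>

definition mean_log_norm :: "complex \<Rightarrow> nat \<Rightarrow> real" where
  "mean_log_norm s n = (\<integral>x. log_norm s n x \<partial>M)"

definition mean_log_entry :: "complex \<Rightarrow> nat \<Rightarrow> real" where
  "mean_log_entry z n = (\<integral>x. log_entry z n x \<partial>M)"

lemma log_norm_nonneg: "cmod s = 1 \<Longrightarrow> x \<in> space M \<Longrightarrow> 0 \<le> log_norm s n x"
  using log_entry_nonneg log_entry_le_log_norm by (meson order_trans)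

text \<open>The uniform bound for the averages \<open>mean_log_norm s n / n\<close> that dominates them in the integral
  over the circle.\<close>

definition growth_bound :: real where
  "growth_bound = (\<integral>x. ln (szego_weight (f x)) \<partial>M) + ln 2"

lemma
  assumes s: "cmod s = 1"
  shows integrable_log_norm: "integrable M (log_norm s n)"
    and mean_log_norm_le: "mean_log_norm s n \<le> n * growth_bound"
proof -
  define G where "G x = (\<Sum>k<n. ln (szego_weight (f ((T ^^ k) x))) + ln 2)" for x
  note int = measure_preserving_integrable[OF preserving integrable_ln_weight]
  have G: "integrable M G"
    unfolding G_def by (intro Bochner_Integration.integrable_sum Bochner_Integration.integrable_add int) auto
  have GI: "(\<integral>x. G x \<partial>M) = n * growth_bound"
    unfolding G_def growth_bound_def
    by (simp add: int prob_space measure_preserving_integral[OF preserving integrable_ln_weight])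
  show 1: "integrable M (log_norm s n)"
  proof (rule Bochner_Integration.integrable_bound[OF G borel_measurable_log_norm[OF s]])
    have "norm (log_norm s n x) \<le> norm (G x)" if "x \<in> space M" for x
      using log_norm_nonneg[OF s that, of n] log_norm_le_sum[OF s that, of n] by (simp add: G_def)
    then show "AE x in M. norm (log_norm s n x) \<le> norm (G x)"
      by simp
  qed
  show "mean_log_norm s n \<le> n * growth_bound"
    unfolding mean_log_norm_def GI[symmetric]
    using log_norm_le_sum[OF s] by (intro integral_mono 1 G) (simp add: G_def)
qed

lemma integrable_log_entry:
  assumes s: "cmod s = 1"
  shows "integrable M (log_entry (s\<^sup>2) n)"
proof (rule Bochner_Integration.integrable_bound[OF integrable_log_norm[OF s]])
  show "log_entry (s\<^sup>2) n \<in> borel_measurable M"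
    using borel_measurable_log_entry[of "\<lambda>x. x" M "\<lambda>_. s\<^sup>2"] by simp
  show "AE x in M. norm (log_entry (s\<^sup>2) n x) \<le> norm (log_norm s n x)"
    using log_entry_nonneg[OF s] log_entry_le_log_norm[OF s] log_norm_nonneg[OF s] by simp
qed

lemma
  assumes s: "cmod s = 1"
  shows mean_log_entry_nonneg: "0 \<le> mean_log_entry (s\<^sup>2) n"
    and mean_log_entry_le: "mean_log_entry (s\<^sup>2) n \<le> mean_log_norm s n"
    and mean_log_norm_le_entry: "mean_log_norm s n \<le> mean_log_entry (s\<^sup>2) n + ln 2"
proof -
  note int = integrable_log_entry[OF s] integrable_log_norm[OF s]
  show "0 \<le> mean_log_entry (s\<^sup>2) n"
    unfolding mean_log_entry_def using log_entry_nonneg[OF s] by (intro integral_nonneg_AE) simp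
  show "mean_log_entry (s\<^sup>2) n \<le> mean_log_norm s n"
    unfolding mean_log_entry_def mean_log_norm_def
    by (intro integral_mono int log_entry_le_log_norm s)
  have "mean_log_norm s n \<le> (\<integral>x. log_entry (s\<^sup>2) n x + ln 2 \<partial>M)"
    unfolding mean_log_norm_def
    by (intro integral_mono int log_norm_le_log_entry s Bochner_Integration.integrable_add) auto
  then show "mean_log_norm s n \<le> mean_log_entry (s\<^sup>2) n + ln 2"
    by (simp add: mean_log_entry_def int prob_space)
qed

lemma mean_log_norm_tendsto:
  assumes s: "cmod s = 1"
  shows "(\<lambda>n. mean_log_norm s n / n) \<longlonglongrightarrow> lyapunov_exponent M T (\<lambda>x. szego_matrix s (f x))"
proof -
  have "convergent (\<lambda>n. mean_log_norm s n / n)"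
  proof (rule subadditive_convergent)
    fix m n
    have int: "integrable M (\<lambda>x. log_norm s m ((T ^^ n) x))"
      by (rule measure_preserving_integrable[OF preserving integrable_log_norm[OF s]])
    have "mean_log_norm s (m + n) \<le> (\<integral>x. log_norm s m ((T ^^ n) x) + log_norm s n x \<partial>M)"
      unfolding mean_log_norm_def
      by (intro integral_mono Bochner_Integration.integrable_add integrable_log_norm s int log_norm_add)
    also have "\<dots> = mean_log_norm s m + mean_log_norm s n"
      using int integrable_log_norm[OF s]
      by (simp add: mean_log_norm_def measure_preserving_integral[OF preserving integrable_log_norm[OF s]])
    finally show "mean_log_norm s (m + n) \<le> mean_log_norm s m + mean_log_norm s n" .
  next
    show "0 \<le> mean_log_norm s n" for n
      using mean_log_entry_nonneg[OF s, of n] mean_log_entry_le[OF s, of n] by linarith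
  qed
  then show ?thesis
    by (simp add: convergent_LIMSEQ_iff lyapunov_exponent_def mean_log_norm_def log_norm_def)
qed

lemma mean_log_entry_tendsto:
  assumes s: "cmod s = 1"
  shows "(\<lambda>n. mean_log_entry (s\<^sup>2) n / n) \<longlonglongrightarrow> lyapunov_exponent M T (\<lambda>x. szego_matrix s (f x))"
proof -
  have "(\<lambda>n. mean_log_norm s n / n - ln 2 / n) \<longlonglongrightarrow>
      lyapunov_exponent M T (\<lambda>x. szego_matrix s (f x)) - 0"
    by (intro tendsto_diff mean_log_norm_tendsto s lim_const_over_n)
  then have "(\<lambda>n. mean_log_norm s n / n - ln 2 / n) \<longlonglongrightarrow>
      lyapunov_exponent M T (\<lambda>x. szego_matrix s (f x))"
    by simp
  then show ?thesis
  proof (rule tendsto_sandwich[OF _ _ _ mean_log_norm_tendsto[OF s], rotated 2])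
    have "mean_log_norm s n / n - ln 2 / n \<le> mean_log_entry (s\<^sup>2) n / n" for n
      using mean_log_norm_le_entry[OF s, of n]
      by (simp add: divide_right_mono flip: diff_divide_distrib)
    then show "\<forall>\<^sub>F n in sequentially. mean_log_norm s n / n - ln 2 / n \<le> mean_log_entry (s\<^sup>2) n / n"
      by simp
    have "mean_log_entry (s\<^sup>2) n / n \<le> mean_log_norm s n / n" for n
      using mean_log_entry_le[OF s] by (intro divide_right_mono) auto
    then show "\<forall>\<^sub>F n in sequentially. mean_log_entry (s\<^sup>2) n / n \<le> mean_log_norm s n / n"
      by simp
  qed
qed

text \<open>The theorem at finite \<open>n\<close>, with no error term. Fubini's theorem applies because
  \<open>log_entry\<close> is nonnegative on the circle: the inner integral of its absolute value is
  \<open>ln (weight_prod n x)\<close>, which is integrable.\<close>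

lemma
  shows mean_log_entry_measurable: "(\<lambda>\<theta>. mean_log_entry (circle_point \<theta>) n) \<in> borel_measurable unit_interval"
    and integral_mean_log_entry:
    "(\<integral>\<theta>. mean_log_entry (circle_point \<theta>) n \<partial>unit_interval) = n * (\<integral>x. ln (szego_weight (f x)) \<partial>M)"
proof -
  interpret N: prob_space unit_interval by (rule prob_space_unit_interval)
  interpret P: pair_sigma_finite M unit_interval ..
  have meas: "(\<lambda>(x, \<theta>). log_entry (circle_point \<theta>) n x) \<in> borel_measurable (M \<Otimes>\<^sub>M unit_interval)"
    unfolding case_prod_beta by (intro borel_measurable_log_entry) measurable
  have meas': "(\<lambda>(\<theta>, x). log_entry (circle_point \<theta>) n x) \<in> borel_measurable (unit_interval \<Otimes>\<^sub>M M)"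
    unfolding case_prod_beta by (intro borel_measurable_log_entry) measurable
  then show "(\<lambda>\<theta>. mean_log_entry (circle_point \<theta>) n) \<in> borel_measurable unit_interval"
    unfolding mean_log_entry_def by (intro borel_measurable_lebesgue_integral)
  \<comment> \<open>\<open>log_entry_nonneg\<close> is stated for a square; any square root of the circle point will do.\<close>
  have nonneg: "0 \<le> log_entry (circle_point \<theta>) n x" if "x \<in> space M" for x \<theta>
    using log_entry_nonneg[OF _ that, of "csqrt (circle_point \<theta>)" n] by (simp add: power2_csqrt norm_csqrt)
  have "integrable (M \<Otimes>\<^sub>M unit_interval) (\<lambda>(x, \<theta>). log_entry (circle_point \<theta>) n x)"
  proof (rule P.Fubini_integrable[OF meas])
    have "(\<integral>\<theta>. norm (case (x, \<theta>) of (x, \<theta>) \<Rightarrow> log_entry (circle_point \<theta>) n x) \<partial>unit_interval)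
        = ln (weight_prod n x)" if "x \<in> space M" for x
      using log_entry_circle_integral[OF that, of n] nonneg[OF that] by simp
    then show "integrable M (\<lambda>x. \<integral>\<theta>. norm (case (x, \<theta>) of (x, \<theta>) \<Rightarrow>
        log_entry (circle_point \<theta>) n x) \<partial>unit_interval)"
      by (subst Bochner_Integration.integrable_cong[OF refl]) (auto intro: integrable_ln_weight_prod)
    show "AE x in M. integrable unit_interval (\<lambda>\<theta>. case (x, \<theta>) of (x, \<theta>) \<Rightarrow> log_entry (circle_point \<theta>) n x)"
      using log_entry_circle_integrable by simp
  qed
  from P.Fubini_integral[OF this]
  have "(\<integral>\<theta>. mean_log_entry (circle_point \<theta>) n \<partial>unit_interval)
      = (\<integral>x. (\<integral>\<theta>. log_entry (circle_point \<theta>) n x \<partial>unit_interval) \<partial>M)"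
    by (simp add: mean_log_entry_def)
  also have "\<dots> = (\<integral>x. ln (weight_prod n x) \<partial>M)"
    by (intro Bochner_Integration.integral_cong log_entry_circle_integral) auto
  finally show "(\<integral>\<theta>. mean_log_entry (circle_point \<theta>) n \<partial>unit_interval)
      = n * (\<integral>x. ln (szego_weight (f x)) \<partial>M)"
    by (simp add: integral_ln_weight_prod)
qed

end

section \<open>The averaged Lyapunov exponent\<close>

theorem proposition1:
  fixes M :: "'a measure" and T :: "'a \<Rightarrow> 'a" and f :: "'a \<Rightarrow> complex"
    and rt :: "complex \<Rightarrow> complex"
  assumes "prob_space M"
    and "measure_preserving M T"
    and "ergodic M T"
    and "f \<in> borel_measurable M"
    and "\<And>x. x \<in> space M \<Longrightarrow> cmod (f x) < 1"
    and "integrable M (\<lambda>x. ln (1 - cmod (f x)))"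
    and "\<And>E. cmod E = 1 \<Longrightarrow> (rt E)\<^sup>2 = E"
  defines "L \<equiv> (\<lambda>E. lyapunov_exponent M T (\<lambda>x. szego_matrix (rt E) (f x)))"
  shows "set_integrable lborel {0..<1::real} (\<lambda>\<theta>. L (exp (2 * of_real pi * \<i> * of_real \<theta>))) \<and>
         (LINT \<theta>:{0..<1::real}|lborel. L (exp (2 * of_real pi * \<i> * of_real \<theta>)))
           = - 1 / 2 * (\<integral>x. ln (1 - (cmod (f x))\<^sup>2) \<partial>M)"
proof -
  interpret szego_cocycle M T f
    using assms(1,2,4-6) by (simp add: szego_cocycle_def szego_cocycle_axioms_def)
  interpret N: prob_space unit_interval by (rule prob_space_unit_interval)
  define u where "u n \<theta> = mean_log_entry (circle_point \<theta>) n / n" for n \<theta>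
  have rt: "(rt (circle_point \<theta>))\<^sup>2 = circle_point \<theta>" "cmod (rt (circle_point \<theta>)) = 1" for \<theta>
  proof -
    show sq: "(rt (circle_point \<theta>))\<^sup>2 = circle_point \<theta>"
      by (rule assms(7)) simp
    have "(cmod (rt (circle_point \<theta>)))\<^sup>2 = 1"
      unfolding norm_power[symmetric] sq by simp
    then show "cmod (rt (circle_point \<theta>)) = 1"
      by (simp add: power2_eq_1_iff) (metis norm_ge_zero not_one_le_zero neg_0_le_iff_le)
  qed
  have lim: "(\<lambda>n. u n \<theta>) \<longlonglongrightarrow> L (circle_point \<theta>)" for \<theta>
    using mean_log_entry_tendsto[OF rt(2)[of \<theta>]] unfolding rt(1) u_def L_def .
  have u_meas: "u n \<in> borel_measurable unit_interval" for n
    unfolding u_def using mean_log_entry_measurable by measurable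
  \<comment> \<open>\<open>L\<close> involves the arbitrary root \<open>rt\<close>; it is measurable as a limit of functions of \<open>E\<close> alone.\<close>
  have L_meas: "(\<lambda>\<theta>. L (circle_point \<theta>)) \<in> borel_measurable unit_interval"
    by (rule borel_measurable_LIMSEQ_real[OF lim u_meas])
  have bound: "norm (u n \<theta>) \<le> norm growth_bound" for n \<theta>
  proof (cases "n = 0")
    case False
    have "0 \<le> mean_log_entry (circle_point \<theta>) n" "mean_log_entry (circle_point \<theta>) n \<le> n * growth_bound"
      using mean_log_entry_nonneg[OF rt(2)[of \<theta>], of n] mean_log_entry_le[OF rt(2)[of \<theta>], of n]
        mean_log_norm_le[OF rt(2)[of \<theta>], of n] unfolding rt(1) by auto
    then have "0 \<le> u n \<theta>" "u n \<theta> \<le> growth_bound"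
      using False unfolding u_def by (auto simp: divide_le_eq mult.commute)
    then show ?thesis by simp
  qed (simp add: u_def)
  have int: "integrable unit_interval (\<lambda>\<theta>. L (circle_point \<theta>))"
    and conv: "(\<lambda>n. \<integral>\<theta>. u n \<theta> \<partial>unit_interval) \<longlonglongrightarrow> (\<integral>\<theta>. L (circle_point \<theta>) \<partial>unit_interval)"
    by (rule integrable_dominated_convergence[where w = "\<lambda>_. norm growth_bound" and s = u]
             integral_dominated_convergence[where w = "\<lambda>_. norm growth_bound" and s = u],
        use L_meas u_meas lim bound in simp_all)+
  have "(\<lambda>n. \<integral>\<theta>. u n \<theta> \<partial>unit_interval) \<longlonglongrightarrow> (\<integral>x. ln (szego_weight (f x)) \<partial>M)"
  proof (rule tendsto_eventually)
    \<comment> \<open>Only \<open>n = 0\<close> is exceptional, where the quotient is \<open>0 / 0 = 0\<close>.\<close>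
    show "\<forall>\<^sub>F n in sequentially. (\<integral>\<theta>. u n \<theta> \<partial>unit_interval) = (\<integral>x. ln (szego_weight (f x)) \<partial>M)"
      using eventually_gt_at_top[of 0]
      by eventually_elim (simp add: u_def integral_mean_log_entry)
  qed
  then have "(\<integral>\<theta>. L (circle_point \<theta>) \<partial>unit_interval) = (\<integral>x. ln (szego_weight (f x)) \<partial>M)"
    using conv LIMSEQ_unique by blast
  also have "\<dots> = (\<integral>x. - 1 / 2 * ln (1 - (cmod (f x))\<^sup>2) \<partial>M)"
    by (intro Bochner_Integration.integral_cong ln_szego_weight f_disc) auto
  also have "\<dots> = - 1 / 2 * (\<integral>x. ln (1 - (cmod (f x))\<^sup>2) \<partial>M)"
    by (rule integral_mult_right_zero)
  finally show ?thesis
    using int by (simp add: integrable_restrict_space integral_restrict_space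
        set_integrable_def set_lebesgue_integral_def)
qed

end
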